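(* Let $n\ge1$, let $E_n = \wedge\{\alpha_1,\dots,\alpha_n,\theta_1,\dots,\theta_n\}$ be the exterior algebra over $\mathbb{C}$ bigraded by $(E_n)_{i,j} = \wedge^i\{\alpha_1,\dots,\alpha_n\}\otimes\wedge^j\{\theta_1,\dots,\theta_n\}$, let $T:E_n\to E_n$ be the algebra homomorphism with $T(\theta_i)=\theta_i+\alpha_i$, $T(\alpha_i)=\alpha_i$, let $H^0(M,\mathcal{O})=\{f\in E_n: T(f)=f\}$ and $H^0(M,\mathcal{O})_{i,j}=H^0(M,\mathcal{O})\cap(E_n)_{i,j}$. Let $\ell = \alpha_1\theta_1+\cdots+\alpha_n\theta_n$. If $i+j\le n$, then multiplication by $\ell^{n-i-j}$ is a linear isomorphism $H^0(M,\mathcal{O})_{i,j}\xrightarrow{\sim} H^0(M,\mathcal{O})_{n-j,n-i}$. *)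

theory Defs
  imports Complex_Main "HOL-Library.Product_Lexorder"
begin

text \<open>
  The exterior algebra over the complex numbers on a linearly ordered set of generators. An element
  is given by its coordinates in the standard basis: the coordinate at a finite set
  \<open>S = {g\<^sub>1 < \<dots> < g\<^sub>k}\<close> belongs to the basis vector \<open>g\<^sub>1 \<and> \<dots> \<and> g\<^sub>k\<close>.
\<close>

typedef 'g exterior =
  "{f :: 'g set \<Rightarrow> complex. finite {S. f S \<noteq> 0} \<and> (\<forall>S. f S \<noteq> 0 \<longrightarrow> finite S)}"
  morphisms coord Abs_exterior
  by (rule exI[of _ "\<lambda>_. 0"]) auto

setup_lifting type_definition_exterior

lemma coord_finite: "finite {S. coord x S \<noteq> 0}"
  and coord_infinite: "infinite S \<Longrightarrow> coord x S = 0"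
  using coord[of x] by auto

lemma exterior_eqI: "(\<And>S. coord x S = coord y S) \<Longrightarrow> x = y"
  by transfer auto

instantiation exterior :: (type) ab_group_add
begin

lift_definition zero_exterior :: "'g exterior" is "\<lambda>_. 0" by auto
lift_definition plus_exterior :: "'g exterior \<Rightarrow> 'g exterior \<Rightarrow> 'g exterior" is "\<lambda>f g S. f S + g S"
proof -
  fix f g :: "'g set \<Rightarrow> complex"
  assume a: "finite {S. f S \<noteq> 0} \<and> (\<forall>S. f S \<noteq> 0 \<longrightarrow> finite S)"
    "finite {S. g S \<noteq> 0} \<and> (\<forall>S. g S \<noteq> 0 \<longrightarrow> finite S)"
  have "{S. f S + g S \<noteq> 0} \<subseteq> {S. f S \<noteq> 0} \<union> {S. g S \<noteq> 0}" by auto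
  with a show "finite {S. f S + g S \<noteq> 0} \<and> (\<forall>S. f S + g S \<noteq> 0 \<longrightarrow> finite S)"
    by (metis (no_types, lifting) add.right_neutral finite_UnI finite_subset)
qed
lift_definition uminus_exterior :: "'g exterior \<Rightarrow> 'g exterior" is "\<lambda>f S. - f S" by simp
definition minus_exterior :: "'g exterior \<Rightarrow> 'g exterior \<Rightarrow> 'g exterior"
  where "minus_exterior x y = x + - y"

instance
  by standard (auto simp: minus_exterior_def intro!: exterior_eqI
      simp: plus_exterior.rep_eq zero_exterior.rep_eq uminus_exterior.rep_eq)

end

lemma coord_add [simp]: "coord (x + y) S = coord x S + coord y S"
  by (simp add: plus_exterior.rep_eq)
lemma coord_0 [simp]: "coord 0 S = 0"
  by (simp add: zero_exterior.rep_eq)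

lift_definition scaleC :: "complex \<Rightarrow> 'g exterior \<Rightarrow> 'g exterior" (infixr "*\<^sub>C" 75)
  is "\<lambda>c f S. c * f S"
  by (auto elim: rev_finite_subset)

lemma coord_scaleC [simp]: "coord (c *\<^sub>C x) S = c * coord x S"
  by (simp add: scaleC.rep_eq)

global_interpretation exterior: vector_space "scaleC :: complex \<Rightarrow> 'g exterior \<Rightarrow> 'g exterior"
  defines exterior_span = exterior.span
    and exterior_subspace = exterior.subspace
  by standard (auto intro!: exterior_eqI simp: algebra_simps)

text \<open>
  For disjoint finite \<open>S\<close> and \<open>U\<close>, \<open>shuffle_sign S U\<close> is the sign of the permutation that sorts the
  list of the elements of \<open>S\<close> in increasing order followed by those of \<open>U\<close> in increasing order.
\<close>

definition inversions :: "'g::linorder set \<Rightarrow> 'g set \<Rightarrow> ('g \<times> 'g) set"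
  where "inversions S U = {(s, u). s \<in> S \<and> u \<in> U \<and> u < s}"

definition shuffle_sign :: "'g::linorder set \<Rightarrow> 'g set \<Rightarrow> complex"
  where "shuffle_sign S U = (-1) ^ card (inversions S U)"

lemma finite_inversions: "finite S \<Longrightarrow> finite U \<Longrightarrow> finite (inversions S U)"
  by (rule finite_subset[of _ "S \<times> U"]) (auto simp: inversions_def)

lemma shuffle_sign_Un_left:
  assumes "finite S" "finite S'" "finite U" "S \<inter> S' = {}"
  shows "shuffle_sign (S \<union> S') U = shuffle_sign S U * shuffle_sign S' U"
proof -
  have "inversions (S \<union> S') U = inversions S U \<union> inversions S' U"
    "inversions S U \<inter> inversions S' U = {}"
    using assms(4) by (auto simp: inversions_def)
  then show ?thesis
    using assms by (simp add: shuffle_sign_def card_Un_disjoint finite_inversions power_add)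
qed

lemma shuffle_sign_Un_right:
  assumes "finite S" "finite U" "finite U'" "U \<inter> U' = {}"
  shows "shuffle_sign S (U \<union> U') = shuffle_sign S U * shuffle_sign S U'"
proof -
  have "inversions S (U \<union> U') = inversions S U \<union> inversions S U'"
    "inversions S U \<inter> inversions S U' = {}"
    using assms(4) by (auto simp: inversions_def)
  then show ?thesis
    using assms by (simp add: shuffle_sign_def card_Un_disjoint finite_inversions power_add)
qed

lemma shuffle_sign_empty [simp]: "shuffle_sign {} U = 1" "shuffle_sign S {} = 1"
  by (simp_all add: shuffle_sign_def inversions_def)

instantiation exterior :: (linorder) ring_1
begin

lift_definition one_exterior :: "'a exterior" is "\<lambda>S. if S = {} then 1 else 0" by auto

lift_definition times_exterior :: "'a exterior \<Rightarrow> 'a exterior \<Rightarrow> 'a exterior"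
  is "\<lambda>f g W. \<Sum>S\<in>Pow W. shuffle_sign S (W - S) * f S * g (W - S)"
proof -
  fix f g :: "'a set \<Rightarrow> complex"
  assume a: "finite {S. f S \<noteq> 0} \<and> (\<forall>S. f S \<noteq> 0 \<longrightarrow> finite S)"
    "finite {S. g S \<noteq> 0} \<and> (\<forall>S. g S \<noteq> 0 \<longrightarrow> finite S)"
  let ?h = "\<lambda>W. \<Sum>S\<in>Pow W. shuffle_sign S (W - S) * f S * g (W - S)"
  have sub: "\<exists>S U. f S \<noteq> 0 \<and> g U \<noteq> 0 \<and> W = S \<union> U" if "?h W \<noteq> 0" for W
  proof -
    obtain S where "S \<in> Pow W" "shuffle_sign S (W - S) * f S * g (W - S) \<noteq> 0"
      using sum.not_neutral_contains_not_neutral[OF \<open>?h W \<noteq> 0\<close>] by blast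
    then show ?thesis
      by (intro exI[of _ S] exI[of _ "W - S"]) auto
  qed
  have "{W. ?h W \<noteq> 0} \<subseteq> (\<lambda>(S, U). S \<union> U) ` ({S. f S \<noteq> 0} \<times> {U. g U \<noteq> 0})"
  proof
    fix W assume "W \<in> {W. ?h W \<noteq> 0}"
    with sub[of W] obtain S U where "f S \<noteq> 0" "g U \<noteq> 0" "W = S \<union> U" by blast
    then show "W \<in> (\<lambda>(S, U). S \<union> U) ` ({S. f S \<noteq> 0} \<times> {U. g U \<noteq> 0})"
      by (intro image_eqI[of _ _ "(S, U)"]) auto
  qed
  moreover have "finite ((\<lambda>(S, U). S \<union> U) ` ({S. f S \<noteq> 0} \<times> {U. g U \<noteq> 0}))"
    using a by blast
  moreover have "finite W" if "?h W \<noteq> 0" for W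
  proof -
    from sub[OF that] obtain S U where "f S \<noteq> 0" "g U \<noteq> 0" "W = S \<union> U" by blast
    with a show ?thesis by blast
  qed
  ultimately show "finite {W. ?h W \<noteq> 0} \<and> (\<forall>W. ?h W \<noteq> 0 \<longrightarrow> finite W)"
    using finite_subset by blast
qed

instance
proof
  fix a b c :: "'a exterior"
  show "a * b * c = a * (b * c)"
  proof (rule exterior_eqI)
    fix W
    show "coord (a * b * c) W = coord (a * (b * c)) W"
    proof (cases "finite W")
      case False
      then show ?thesis by (simp add: coord_infinite)
    next
      case fin: True
      have "coord (a * b * c) W = (\<Sum>X\<in>Pow W. \<Sum>S\<in>Pow X.
          shuffle_sign X (W - X) * (shuffle_sign S (X - S) * coord a S * coord b (X - S)) * coord c (W - X))"
        by (simp add: times_exterior.rep_eq sum_distrib_left sum_distrib_right)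
      also have "\<dots> = (\<Sum>(X, S)\<in>(SIGMA X:Pow W. Pow X).
          shuffle_sign X (W - X) * (shuffle_sign S (X - S) * coord a S * coord b (X - S)) * coord c (W - X))"
        using fin by (subst sum.Sigma) (auto intro: finite_subset)
      also have "\<dots> = (\<Sum>(S, Y)\<in>(SIGMA S:Pow W. Pow (W - S)).
          shuffle_sign S (W - S) * coord a S * (shuffle_sign Y (W - S - Y) * coord b Y * coord c (W - S - Y)))"
      proof (rule sum.reindex_bij_witness[of _ "\<lambda>(S, Y). (S \<union> Y, S)" "\<lambda>(X, S). (S, X - S)"], goal_cases)
        case (5 p)
        obtain X S where p: "p = (X, S)" by (cases p)
        with 5 have XS: "X \<subseteq> W" "S \<subseteq> X" by auto
        then have f: "finite S" "finite (X - S)" "finite (W - X)" 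
          using fin by (auto intro: finite_subset)
        have "shuffle_sign X (W - X) = shuffle_sign (S \<union> (X - S)) (W - X)"
          using XS by (simp add: Un_absorb1)
        also have "\<dots> = shuffle_sign S (W - X) * shuffle_sign (X - S) (W - X)"
          using f by (intro shuffle_sign_Un_left) auto
        finally have 1: "shuffle_sign X (W - X) = \<dots>" .
        have "W - S = (X - S) \<union> (W - X)" using XS by auto
        then have "shuffle_sign S (W - S) = shuffle_sign S ((X - S) \<union> (W - X))" by simp
        also have "\<dots> = shuffle_sign S (X - S) * shuffle_sign S (W - X)"
          using f by (intro shuffle_sign_Un_right) auto
        finally have 2: "shuffle_sign S (W - S) = \<dots>" .
        have 3: "W - S - (X - S) = W - X" using XS by auto
        show ?case unfolding p by (simp add: 1 2 3)
      qed auto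
      also have "\<dots> = (\<Sum>S\<in>Pow W. \<Sum>Y\<in>Pow (W - S).
          shuffle_sign S (W - S) * coord a S * (shuffle_sign Y (W - S - Y) * coord b Y * coord c (W - S - Y)))"
        using fin by (subst sum.Sigma) auto
      also have "\<dots> = coord (a * (b * c)) W"
        by (simp add: times_exterior.rep_eq sum_distrib_left)
      finally show ?thesis .
    qed
  qed
  show "1 * a = a"
  proof (rule exterior_eqI)
    fix W
    have "coord (1 * a) W = (\<Sum>S\<in>Pow W. if S = {} then coord a W else 0)"
      by (auto simp: times_exterior.rep_eq one_exterior.rep_eq intro!: sum.cong)
    then show "coord (1 * a) W = coord a W"
      by (cases "finite W") (auto simp: coord_infinite)
  qed
  show "a * 1 = a"
  proof (rule exterior_eqI)
    fix W
    have "coord (a * 1) W = (\<Sum>S\<in>Pow W. if S = W then coord a W else 0)"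
      by (auto simp: times_exterior.rep_eq one_exterior.rep_eq intro!: sum.cong)
    then show "coord (a * 1) W = coord a W"
      by (cases "finite W") (auto simp: coord_infinite)
  qed
  show "(a + b) * c = a * c + b * c" "a * (b + c) = a * b + a * c"
    by (auto intro!: exterior_eqI simp: times_exterior.rep_eq algebra_simps sum.distrib)
  show "(0 :: 'a exterior) \<noteq> 1"
    by (metis (full_types) one_exterior.rep_eq zero_exterior.rep_eq zero_neq_one)
qed

end

lemma scaleC_mult_left: "c *\<^sub>C x * y = c *\<^sub>C (x * y)"
  and scaleC_mult_right: "x * c *\<^sub>C y = c *\<^sub>C (x * y)"
  for x y :: "'g::linorder exterior"
  by (auto intro!: exterior_eqI simp: times_exterior.rep_eq sum_distrib_left mult_ac)

lift_definition basis_vector :: "'g set \<Rightarrow> 'g exterior"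
  is "\<lambda>S U. if finite S \<and> U = S then 1 else 0"
  by auto

definition generator :: "'g \<Rightarrow> 'g exterior"
  where "generator g = basis_vector {g}"

lemma coord_basis_vector: "finite S \<Longrightarrow> coord (basis_vector S) U = (if U = S then 1 else 0)"
  by (simp add: basis_vector.rep_eq)

lemma basis_vector_mult:
  fixes S U :: "'g::linorder set"
  assumes "finite S" "finite U"
  shows "basis_vector S * basis_vector U =
    (if S \<inter> U = {} then shuffle_sign S U *\<^sub>C basis_vector (S \<union> U) else 0)"
proof (rule exterior_eqI)
  fix W
  have "coord (basis_vector S * basis_vector U) W =
      (\<Sum>X\<in>Pow W. if X = S then (if W - S = U then shuffle_sign S U else 0) else 0)"
    unfolding times_exterior.rep_eq using assms by (intro sum.cong) (auto simp: coord_basis_vector)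
  also have "\<dots> = (if finite W \<and> S \<subseteq> W \<and> W - S = U then shuffle_sign S U else 0)"
    by (cases "finite W") auto
  also have "\<dots> = coord (if S \<inter> U = {} then shuffle_sign S U *\<^sub>C basis_vector (S \<union> U) else 0) W"
    using assms by (auto simp: coord_basis_vector)
  finally show "coord (basis_vector S * basis_vector U) W = \<dots>" .
qed

lemma generator_square: "generator g * generator g = (0 :: 'g::linorder exterior)"
  by (simp add: generator_def basis_vector_mult)

lemma generator_anticommute:
  "generator g * generator h = - (generator h * generator g :: 'g::linorder exterior)"
proof (cases g h rule: linorder_cases)
  case equal
  then show ?thesis by (simp add: generator_square)
next
  case less
  then have "inversions {h} {g} = {(h, g)}" "inversions {g} {h} = {}" by (auto simp: inversions_def)
  with less show ?thesis 
    by (auto simp: generator_def basis_vector_mult shuffle_sign_def insert_commute)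
next
  case greater
  then have "inversions {g} {h} = {(g, h)}" "inversions {h} {g} = {}" by (auto simp: inversions_def)
  with greater show ?thesis 
    by (auto simp: generator_def basis_vector_mult shuffle_sign_def insert_commute)
qed


definition increasing_product :: "('i::linorder \<Rightarrow> 'a::monoid_mult) \<Rightarrow> 'i set \<Rightarrow> 'a"
  where "increasing_product f S = prod_list (map f (sorted_list_of_set S))"

lemma increasing_product_empty [simp]: "increasing_product f {} = 1"
  by (simp add: increasing_product_def)

lemma increasing_product_singleton [simp]: "increasing_product f {k} = f k"
  by (simp add: increasing_product_def)

lemma increasing_product_insert_min:
  assumes "finite S" "\<forall>s\<in>S. m < s"
  shows "increasing_product f (insert m S) = f m * increasing_product f S"
proof -
  have "m \<notin> S" using assms(2) by auto
  then have "sorted_list_of_set (insert m S) = insort m (sorted_list_of_set S)"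
    using assms(1) by simp
  also have "\<dots> = m # sorted_list_of_set S"
    using assms by (intro insort_is_Cons) auto
  finally show ?thesis by (simp add: increasing_product_def)
qed

lemma shuffle_sign_less: "\<forall>s\<in>S. \<forall>u\<in>U. s < u \<Longrightarrow> shuffle_sign S U = 1"
proof -
  assume "\<forall>s\<in>S. \<forall>u\<in>U. s < u"
  then have "inversions S U = {}" by (fastforce simp: inversions_def dest: order.asym)
  then show ?thesis by (simp add: shuffle_sign_def)
qed

lemma basis_vector_eq_increasing_product:
  "finite S \<Longrightarrow> basis_vector S = increasing_product generator S"
proof (induction S rule: finite_linorder_min_induct)
  case empty
  show ?case by (auto intro!: exterior_eqI simp: coord_basis_vector one_exterior.rep_eq)
next
  case (insert m S)
  have "m \<notin> S" using insert by blast
  then have "generator m * basis_vector S = basis_vector (insert m S)"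
    using insert.hyps by (simp add: generator_def basis_vector_mult shuffle_sign_less)
  with insert show ?case by (simp add: increasing_product_insert_min)
qed

lemma exterior_expand:
  assumes "finite A" "{S. coord x S \<noteq> 0} \<subseteq> A"
  shows "x = (\<Sum>S\<in>A. coord x S *\<^sub>C basis_vector S)"
proof (rule exterior_eqI)
  fix U
  have *: "coord (\<Sum>S\<in>A. h S) U = (\<Sum>S\<in>A. coord (h S) U)" for h :: "'a set \<Rightarrow> 'a exterior"
    using assms(1) by (induction A rule: finite_induct) auto
  have "coord (\<Sum>S\<in>A. coord x S *\<^sub>C basis_vector S) U = (\<Sum>S\<in>A. if U = S then coord x U else 0)"
    unfolding * by (intro sum.cong) (auto simp: basis_vector.rep_eq coord_infinite)
  also have "\<dots> = coord x U" using assms by auto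
  finally show "coord x U = coord (\<Sum>S\<in>A. coord x S *\<^sub>C basis_vector S) U" ..
qed


text \<open>
  Universal property: elements \<open>\<phi> g\<close> with \<open>\<phi> g * \<phi> g = 0\<close> and \<open>\<phi> g * \<phi> h = - \<phi> h * \<phi> g\<close> extend to an
  algebra endomorphism.
\<close>

definition extend_hom :: "('g::linorder \<Rightarrow> 'g exterior) \<Rightarrow> 'g exterior \<Rightarrow> 'g exterior"
  where "extend_hom \<phi> x = (\<Sum>S | coord x S \<noteq> 0. coord x S *\<^sub>C increasing_product \<phi> S)"

lemma extend_hom_eq:
  assumes "finite A" "{S. coord x S \<noteq> 0} \<subseteq> A"
  shows "extend_hom \<phi> x = (\<Sum>S\<in>A. coord x S *\<^sub>C increasing_product \<phi> S)"
  unfolding extend_hom_def by (rule sum.mono_neutral_left) (use assms in auto)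

lemma extend_hom_add: "extend_hom \<phi> (x + y) = extend_hom \<phi> x + extend_hom \<phi> y"
proof -
  let ?A = "{S. coord x S \<noteq> 0} \<union> {S. coord y S \<noteq> 0}"
  have "finite ?A" by (simp add: coord_finite)
  then have "extend_hom \<phi> z = (\<Sum>S\<in>?A. coord z S *\<^sub>C increasing_product \<phi> S)"
    if "z \<in> {x, y, x + y}" for z
    using that by (intro extend_hom_eq) auto
  then show ?thesis
    by (simp add: exterior.scale_left_distrib sum.distrib)
qed

lemma extend_hom_scale: "extend_hom \<phi> (c *\<^sub>C x) = c *\<^sub>C extend_hom \<phi> x"
proof -
  have "extend_hom \<phi> (c *\<^sub>C x) =
      (\<Sum>S | coord x S \<noteq> 0. coord (c *\<^sub>C x) S *\<^sub>C increasing_product \<phi> S)"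
    by (intro extend_hom_eq) (auto simp: coord_finite)
  then show ?thesis by (simp add: extend_hom_def exterior.scale_sum_right)
qed

lemma extend_hom_sum: "extend_hom \<phi> (\<Sum>a\<in>A. f a) = (\<Sum>a\<in>A. extend_hom \<phi> (f a))"
  by (induction A rule: infinite_finite_induct) (auto simp: extend_hom_add, auto simp: extend_hom_def)

lemma extend_hom_basis_vector: "finite S \<Longrightarrow> extend_hom \<phi> (basis_vector S) = increasing_product \<phi> S"
  by (subst extend_hom_eq[of "{S}"]) (auto simp: coord_basis_vector)

lemma extend_hom_generator: "extend_hom \<phi> (generator g) = \<phi> g"
  by (simp add: generator_def extend_hom_basis_vector)

lemma extend_hom_1: "extend_hom \<phi> 1 = 1"
  by (metis basis_vector_eq_increasing_product extend_hom_basis_vector finite.emptyI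
      increasing_product_empty)

lemma mult_increasing_product:
  fixes \<phi> :: "'g::linorder \<Rightarrow> 'g exterior"
  assumes sq: "\<And>g. \<phi> g * \<phi> g = 0" and anti: "\<And>g h. \<phi> g * \<phi> h = - (\<phi> h * \<phi> g)"
  assumes "finite U"
  shows "\<phi> g * increasing_product \<phi> U =
    (if g \<in> U then 0 else shuffle_sign {g} U *\<^sub>C increasing_product \<phi> (insert g U))"
  using \<open>finite U\<close>
proof (induction U rule: finite_linorder_min_induct)
  case empty
  then show ?case by simp
next
  case (insert m U)
  have P: "increasing_product \<phi> (insert m U) = \<phi> m * increasing_product \<phi> U"
    using insert by (simp add: increasing_product_insert_min)
  consider "g < m" | "g = m" | "m < g" by force
  then show ?case
  proof cases
    case 1
    then have "\<forall>u\<in>insert m U. g < u" using insert by auto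
    moreover from this have "g \<notin> insert m U" by blast
    moreover from calculation have "shuffle_sign {g} (insert m U) = 1"
      by (intro shuffle_sign_less) auto
    ultimately show ?thesis
      using insert.hyps by (simp add: increasing_product_insert_min[of "insert m U" g] del: insert_iff)
  next
    case 2
    then show ?thesis unfolding P by (simp add: mult.assoc[symmetric] sq)
  next
    case 3
    have "\<phi> g * increasing_product \<phi> (insert m U) = - (\<phi> m * (\<phi> g * increasing_product \<phi> U))"
      unfolding P using anti[of g m] by (simp add: mult.assoc[symmetric])
    also have "\<dots> = (if g \<in> U then 0
        else - (shuffle_sign {g} U *\<^sub>C (\<phi> m * increasing_product \<phi> (insert g U))))"
      using insert.IH by (simp add: scaleC_mult_right)
    also have "\<phi> m * increasing_product \<phi> (insert g U) = increasing_product \<phi> (insert m (insert g U))"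
      using insert.hyps 3 by (subst increasing_product_insert_min) auto
    also have "shuffle_sign {g} (insert m U) = - shuffle_sign {g} U"
    proof -
      have "inversions {g} {m} = {(g, m)}" using 3 by (auto simp: inversions_def)
      then have "shuffle_sign {g} {m} = -1" by (simp add: shuffle_sign_def)
      moreover have "shuffle_sign {g} ({m} \<union> U) = shuffle_sign {g} {m} * shuffle_sign {g} U"
        using insert by (intro shuffle_sign_Un_right) auto
      ultimately show ?thesis by simp
    qed
    then have "- (shuffle_sign {g} U *\<^sub>C z) = shuffle_sign {g} (insert m U) *\<^sub>C z" for z :: "'g exterior"
      by simp
    finally show ?thesis using 3 by (auto simp: insert_commute)
  qed
qed

lemma increasing_product_mult:
  fixes \<phi> :: "'g::linorder \<Rightarrow> 'g exterior"
  assumes sq: "\<And>g. \<phi> g * \<phi> g = 0" and anti: "\<And>g h. \<phi> g * \<phi> h = - (\<phi> h * \<phi> g)"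
  assumes "finite S" and U: "finite U"
  shows "increasing_product \<phi> S * increasing_product \<phi> U =
    (if S \<inter> U = {} then shuffle_sign S U *\<^sub>C increasing_product \<phi> (S \<union> U) else 0)"
  using \<open>finite S\<close>
proof (induction S rule: finite_linorder_min_induct)
  case empty
  then show ?case by simp
next
  case (insert m S)
  have "increasing_product \<phi> (insert m S) * increasing_product \<phi> U =
      \<phi> m * (increasing_product \<phi> S * increasing_product \<phi> U)"
    using insert by (simp add: increasing_product_insert_min mult.assoc)
  also have "\<dots> = (if S \<inter> U = {}
      then shuffle_sign S U *\<^sub>C (\<phi> m * increasing_product \<phi> (S \<union> U)) else 0)"
    using insert.IH by (simp add: scaleC_mult_right)
  also have "\<dots> = (if insert m S \<inter> U = {}
      then (shuffle_sign S U * shuffle_sign {m} (S \<union> U)) *\<^sub>C increasing_product \<phi> (insert m S \<union> U) else 0)"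
    using insert.hyps U by (auto simp: mult_increasing_product[of \<phi>, OF sq anti])
  also have "shuffle_sign S U * shuffle_sign {m} (S \<union> U) = shuffle_sign (insert m S) U"
    if "insert m S \<inter> U = {}"
  proof -
    have "shuffle_sign {m} (S \<union> U) = shuffle_sign {m} S * shuffle_sign {m} U"
      using insert.hyps U that by (intro shuffle_sign_Un_right) auto
    moreover have "shuffle_sign {m} S = 1" using insert.hyps by (intro shuffle_sign_less) auto
    moreover have "shuffle_sign ({m} \<union> S) U = shuffle_sign {m} U * shuffle_sign S U"
      using insert.hyps U by (intro shuffle_sign_Un_left) auto
    ultimately show ?thesis by simp
  qed
  then have "(if insert m S \<inter> U = {}
      then (shuffle_sign S U * shuffle_sign {m} (S \<union> U)) *\<^sub>C increasing_product \<phi> (insert m S \<union> U) else 0) =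
    (if insert m S \<inter> U = {} then shuffle_sign (insert m S) U *\<^sub>C increasing_product \<phi> (insert m S \<union> U) else 0)"
    by (simp del: Un_insert_left)
  finally show ?case .
qed

lemma extend_hom_mult:
  fixes \<phi> :: "'g::linorder \<Rightarrow> 'g exterior"
  assumes sq: "\<And>g. \<phi> g * \<phi> g = 0" and anti: "\<And>g h. \<phi> g * \<phi> h = - (\<phi> h * \<phi> g)"
  shows "extend_hom \<phi> (x * y) = extend_hom \<phi> x * extend_hom \<phi> y"
proof -
  have basis: "extend_hom \<phi> (basis_vector S * basis_vector U) =
      extend_hom \<phi> (basis_vector S) * extend_hom \<phi> (basis_vector U)"
    if "finite S" "finite U" for S U
  proof -
    have "extend_hom \<phi> 0 = 0" by (simp add: extend_hom_def)
    with that show ?thesis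
      by (simp add: basis_vector_mult extend_hom_basis_vector extend_hom_scale
          increasing_product_mult[of \<phi>, OF sq anti])
  qed
  let ?A = "{S. coord x S \<noteq> 0}" and ?B = "{S. coord y S \<noteq> 0}"
  have fin: "finite S" if "S \<in> ?A \<union> ?B" for S using that coord_infinite by blast
  have x: "x = (\<Sum>S\<in>?A. coord x S *\<^sub>C basis_vector S)"
    and y: "y = (\<Sum>S\<in>?B. coord y S *\<^sub>C basis_vector S)"
    by (intro exterior_expand; simp add: coord_finite)+
  have "x * y = (\<Sum>S\<in>?A. \<Sum>U\<in>?B. (coord x S * coord y U) *\<^sub>C (basis_vector S * basis_vector U))"
    by (subst x, subst y) (simp add: sum_product scaleC_mult_left scaleC_mult_right mult.commute)
  then have "extend_hom \<phi> (x * y) = (\<Sum>S\<in>?A. \<Sum>U\<in>?B.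
      (coord x S * coord y U) *\<^sub>C (extend_hom \<phi> (basis_vector S) * extend_hom \<phi> (basis_vector U)))"
    by (simp add: extend_hom_sum extend_hom_scale basis fin)
  also have "\<dots> = (\<Sum>S\<in>?A. coord x S *\<^sub>C increasing_product \<phi> S) *
      (\<Sum>U\<in>?B. coord y U *\<^sub>C increasing_product \<phi> U)"
    by (simp add: sum_product scaleC_mult_left scaleC_mult_right mult.commute extend_hom_basis_vector fin)
  finally show ?thesis by (simp add: extend_hom_def)
qed

text \<open>
  Every \<open>E\<^sub>n\<close> is realised inside the exterior algebra on the generators \<open>\<alpha>\<^sub>k, \<theta>\<^sub>k\<close>, \<open>k \<in> \<nat>\<close>; in the
  lexicographic order every \<open>\<alpha>\<close> precedes every \<open>\<theta>\<close>.
\<close>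

type_synonym E_ambient = "(bool \<times> nat) exterior"

definition alpha :: "nat \<Rightarrow> E_ambient" where "alpha k = generator (False, k)"
definition theta :: "nat \<Rightarrow> E_ambient" where "theta k = generator (True, k)"

definition monomial :: "nat set \<Rightarrow> nat set \<Rightarrow> E_ambient"
  where "monomial I J = increasing_product alpha I * increasing_product theta J"

definition E :: "nat \<Rightarrow> E_ambient set"
  where "E n = exterior_span {monomial I J | I J. I \<subseteq> {1..n} \<and> J \<subseteq> {1..n}}"

definition E_bideg :: "nat \<Rightarrow> nat \<Rightarrow> nat \<Rightarrow> E_ambient set"
  where "E_bideg n i j =
    exterior_span {monomial I J | I J. I \<subseteq> {1..n} \<and> J \<subseteq> {1..n} \<and> card I = i \<and> card J = j}"

definition algebra_hom_on :: "E_ambient set \<Rightarrow> E_ambient set \<Rightarrow> (E_ambient \<Rightarrow> E_ambient) \<Rightarrow> bool"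
  where "algebra_hom_on A B T \<longleftrightarrow>
    T ` A \<subseteq> B \<and> T 1 = 1 \<and>
    (\<forall>x\<in>A. \<forall>y\<in>A. T (x + y) = T x + T y) \<and>
    (\<forall>x\<in>A. \<forall>y\<in>A. T (x * y) = T x * T y) \<and>
    (\<forall>c. \<forall>x\<in>A. T (c *\<^sub>C x) = c *\<^sub>C T x)"

definition H0 :: "nat \<Rightarrow> (E_ambient \<Rightarrow> E_ambient) \<Rightarrow> E_ambient set"
  where "H0 n T = {f \<in> E n. T f = f}"

definition H0_bideg :: "nat \<Rightarrow> (E_ambient \<Rightarrow> E_ambient) \<Rightarrow> nat \<Rightarrow> nat \<Rightarrow> E_ambient set"
  where "H0_bideg n T i j = H0 n T \<inter> E_bideg n i j"

definition ell :: "nat \<Rightarrow> E_ambient"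
  where "ell n = (\<Sum>k = 1..n. alpha k * theta k)"

definition linear_iso_on :: "E_ambient set \<Rightarrow> E_ambient set \<Rightarrow> (E_ambient \<Rightarrow> E_ambient) \<Rightarrow> bool"
  where "linear_iso_on V W f \<longleftrightarrow>
    exterior_subspace V \<and> exterior_subspace W \<and>
    (\<forall>x\<in>V. \<forall>y\<in>V. f (x + y) = f x + f y) \<and>
    (\<forall>c. \<forall>x\<in>V. f (c *\<^sub>C x) = c *\<^sub>C f x) \<and>
    bij_betw f V W"

lemma basis_vector_eq_monomial:
  assumes "finite I" "finite J"
  shows "basis_vector (Pair False ` I \<union> Pair True ` J) = monomial I J"
proof -
  have *: "increasing_product (\<lambda>k. generator (b, k)) K = basis_vector (Pair b ` K)" if "finite K" for K :: "nat set" and b :: bool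
    using that
  proof (induction K rule: finite_linorder_min_induct)
    case empty
    then show ?case using basis_vector_eq_increasing_product[of "{}"] by simp
  next
    case (insert m K)
    have "generator (b, m) * basis_vector (Pair b ` K) = basis_vector (insert (b, m) (Pair b ` K))"
      using insert.hyps by (auto simp: generator_def basis_vector_mult shuffle_sign_less)
    with insert show ?case by (simp add: increasing_product_insert_min)
  qed
  have "monomial I J = basis_vector (Pair False ` I) * basis_vector (Pair True ` J)"
    using * assms by (simp add: monomial_def alpha_def[abs_def] theta_def[abs_def])
  also have "\<dots> = basis_vector (Pair False ` I \<union> Pair True ` J)"
    using assms by (subst basis_vector_mult) (auto simp: shuffle_sign_less)
  finally show ?thesis ..
qed

lemma mem_E_iff: "x \<in> E n \<longleftrightarrow> (\<forall>S. coord x S \<noteq> 0 \<longrightarrow> S \<subseteq> UNIV \<times> {1..n})"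
proof
  assume "x \<in> E n"
  then show "\<forall>S. coord x S \<noteq> 0 \<longrightarrow> S \<subseteq> UNIV \<times> {1..n}"
    unfolding E_def
  proof (induction rule: exterior.span_induct_alt)
    case (step c m y)
    then obtain I J where IJ: "I \<subseteq> {1..n}" "J \<subseteq> {1..n}" "m = monomial I J" by auto
    then have "finite I" "finite J" by (auto intro: finite_subset)
    then have "coord m S = (if S = Pair False ` I \<union> Pair True ` J then 1 else 0)" for S
      by (simp add: IJ(3) basis_vector_eq_monomial[symmetric] coord_basis_vector)
    with IJ step show ?case by (auto split: if_splits)
  qed simp
next
  assume r: "\<forall>S. coord x S \<noteq> 0 \<longrightarrow> S \<subseteq> UNIV \<times> {1..n}"
  have "coord x S *\<^sub>C basis_vector S \<in> E n" if "coord x S \<noteq> 0" for S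
  proof -
    let ?I = "Pair False -` S" and ?J = "Pair True -` S"
    have sub: "?I \<subseteq> {1..n}" "?J \<subseteq> {1..n}" using r that by auto
    have "S = Pair False ` ?I \<union> Pair True ` ?J"
    proof safe
      fix b k assume "(b, k) \<in> S" "(b, k) \<notin> Pair True ` ?J"
      then show "(b, k) \<in> Pair False ` ?I" by (cases b) auto
    qed
    with sub have "basis_vector S = monomial ?I ?J"
      by (metis basis_vector_eq_monomial finite_atLeastAtMost finite_subset)
    with sub show ?thesis
      unfolding E_def by (intro exterior.span_scale, intro exterior.span_base) auto
  qed
  then have "(\<Sum>S | coord x S \<noteq> 0. coord x S *\<^sub>C basis_vector S) \<in> E n"
    unfolding E_def by (intro exterior.span_sum) auto
  then show "x \<in> E n" using exterior_expand[of "{S. coord x S \<noteq> 0}" x] coord_finite[of x] by simp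
qed

text \<open>The homomorphism \<open>T\<close> exists for every \<open>n\<close>.\<close>

lemma ex_T:
  "\<exists>T. algebra_hom_on (E n) (E n) T \<and>
    (\<forall>k\<in>{1..n}. T (theta k) = theta k + alpha k) \<and> (\<forall>k\<in>{1..n}. T (alpha k) = alpha k)"
proof -
  define \<phi> where "\<phi> = (\<lambda>(b, k). if b then theta k + alpha k else alpha k)"
  have anti: "\<phi> g * \<phi> h = - (\<phi> h * \<phi> g)" for g h
  proof -
    obtain b k c l where gh: "g = (b, k)" "h = (c, l)" by (cases g; cases h)
    have "alpha k * alpha l = - (alpha l * alpha k)" "theta k * theta l = - (theta l * theta k)"
      "theta k * alpha l = - (alpha l * theta k)" "theta l * alpha k = - (alpha k * theta l)"
      unfolding alpha_def theta_def by (rule generator_anticommute)+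
    then show ?thesis
      by (simp add: gh \<phi>_def distrib_left distrib_right)
  qed
  have sq: "\<phi> g * \<phi> g = 0" for g
  proof -
    obtain b k where g: "g = (b, k)" by (cases g)
    have "alpha k * alpha k = 0" "theta k * theta k = 0"
      unfolding alpha_def theta_def by (rule generator_square)+
    moreover have "theta k * alpha k = - (alpha k * theta k)"
      unfolding alpha_def theta_def by (rule generator_anticommute)
    ultimately show ?thesis
      by (simp add: g \<phi>_def distrib_left distrib_right)
  qed
  have mult: "x * y \<in> E n" if "x \<in> E n" "y \<in> E n" for x y
    unfolding mem_E_iff
  proof (intro allI impI)
    fix W assume "coord (x * y) W \<noteq> 0"
    then obtain S where "S \<in> Pow W" "shuffle_sign S (W - S) * coord x S * coord y (W - S) \<noteq> 0"
      unfolding times_exterior.rep_eq using sum.not_neutral_contains_not_neutral by blast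
    with that have "S \<subseteq> UNIV \<times> {1..n}" "W - S \<subseteq> UNIV \<times> {1..n}" by (auto simp: mem_E_iff)
    then show "W \<subseteq> UNIV \<times> {1..n}" by blast
  qed
  have one: "1 \<in> E n" by (auto simp: mem_E_iff one_exterior.rep_eq split: if_splits)
  have gen: "\<phi> (b, k) \<in> E n" if "k \<in> {1..n}" for b k
    using that by (auto simp: mem_E_iff \<phi>_def alpha_def theta_def generator_def coord_basis_vector split: if_splits)
  have prod: "increasing_product \<phi> S \<in> E n" if "finite S" "S \<subseteq> UNIV \<times> {1..n}" for S
    using that
  proof (induction S rule: finite_linorder_min_induct)
    case (insert g S)
    then show ?case using gen[of "snd g" "fst g"] by (auto simp: increasing_product_insert_min intro!: mult)
  qed (simp add: one)
  have "extend_hom \<phi> x \<in> E n" if "x \<in> E n" for x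
  proof -
    have "increasing_product \<phi> S \<in> E n" if "coord x S \<noteq> 0" for S
      using that \<open>x \<in> E n\<close> coord_infinite by (intro prod) (auto simp: mem_E_iff)
    then show ?thesis unfolding extend_hom_def E_def
      by (intro exterior.span_sum exterior.span_scale) auto
  qed
  then have "algebra_hom_on (E n) (E n) (extend_hom \<phi>)"
    by (auto simp: algebra_hom_on_def extend_hom_1 extend_hom_add extend_hom_scale
        extend_hom_mult[of \<phi>, OF sq anti])
  moreover have "extend_hom \<phi> (theta k) = theta k + alpha k" "extend_hom \<phi> (alpha k) = alpha k" for k
    by (simp_all add: alpha_def theta_def extend_hom_generator) (simp_all add: \<phi>_def alpha_def theta_def)
  ultimately show ?thesis by blast
qed

end

theory Submission
  imports Defs
begin

text \<open>
  Since \<open>T\<close> fixes every \<open>\<alpha>\<^sub>k\<theta>\<^sub>k\<close>, it fixes \<open>\<ell>\<close>, so multiplication by a power of \<open>\<ell>\<close> commutes with \<open>T\<close>.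
  Everything follows from hard Lefschetz for the full exterior algebra: \<open>\<ell>^(n - k)\<close> is injective in
  total degree \<open>k \<le> n\<close>, and \<open>\<ell>^(n - i - j)\<close> maps bidegree \<open>(i, j)\<close> onto bidegree \<open>(n - j, n - i)\<close>. Indeed,
  if \<open>g = \<ell>^m f\<close> is fixed by \<open>T\<close>, then \<open>\<ell>^m (T f - f) = 0\<close>, and \<open>T f - f\<close> has the same total degree as \<open>f\<close>.

  Hard Lefschetz is proved by induction on \<open>n\<close>. Write \<open>\<alpha>, \<theta>\<close> for the last pair of generators, \<open>\<kappa>\<close> for
  the \<open>\<ell>\<close> of the other ones and \<open>f = p + \<theta> q + \<alpha> (r + \<theta> s)\<close>. As \<open>\<ell>^m = \<kappa>^m + m \<alpha>\<theta> \<kappa>^(m - 1)\<close>,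
  the components of \<open>\<ell>^m f\<close> are \<open>\<kappa>^m p\<close>, \<open>\<kappa>^m q\<close>, \<open>\<kappa>^m r\<close> and \<open>\<kappa>^m s + m \<kappa>^(m - 1) p\<close>. The second
  and third are governed by the induction hypothesis; multiplying the last one by \<open>\<kappa>\<close> and subtracting
  \<open>m\<close> times the first leaves \<open>\<kappa>^(m + 1) s\<close>, to which the induction hypothesis applies, and then it
  applies to \<open>\<kappa>^(m - 1) p\<close>.
\<close>

section \<open>Splitting off a generator\<close>

lemma shuffle_sign_square: "shuffle_sign S U * shuffle_sign S U = 1"
  by (simp add: shuffle_sign_def flip: power_add)

lemma coord_diff [simp]: "coord (x - y) S = coord x S - coord y S"
  by (simp only: minus_exterior_def coord_add uminus_exterior.rep_eq) simp

lemma of_nat_mult_exterior: "of_nat m * x = of_nat m *\<^sub>C (x :: 'g::linorder exterior)"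
  by (induction m) (simp_all add: distrib_right exterior.scale_left_distrib)

lemma coord_generator_mult:
  "coord (generator g * x) W =
    (if g \<in> W then shuffle_sign {g} (W - {g}) * coord x (W - {g}) else 0)"
proof (cases "finite W")
  case True
  have "coord (generator g * x) W =
      (\<Sum>S\<in>Pow W. if S = {g} then shuffle_sign {g} (W - {g}) * coord x (W - {g}) else 0)"
    unfolding times_exterior.rep_eq generator_def
    by (intro sum.cong) (auto simp: coord_basis_vector)
  then show ?thesis using True by simp
qed (simp add: coord_infinite)

text \<open>The subalgebra on the generators other than \<open>g\<close>, described through
  supports.\<close>

definition free_of :: "'g \<Rightarrow> 'g exterior \<Rightarrow> bool"
  where "free_of g x \<longleftrightarrow> (\<forall>S. coord x S \<noteq> 0 \<longrightarrow> g \<notin> S)"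

lemma free_of_add: "free_of g x \<Longrightarrow> free_of g y \<Longrightarrow> free_of g (x + y)"
  unfolding free_of_def coord_add by (metis add.right_neutral)

lemma free_of_generator_mult: "g \<noteq> h \<Longrightarrow> free_of g x \<Longrightarrow> free_of g (generator h * x)"
  by (auto simp: free_of_def coord_generator_mult split: if_splits)

text \<open>Every support set of \<open>generator g * y\<close> contains \<open>g\<close> and none
  of \<open>x\<close> does, so nothing cancels; multiplying by \<open>g\<close> only relabels the
  coordinates of \<open>y\<close> up to sign.\<close>

lemma free_of_split_eq_0:
  assumes "free_of g x" "free_of g y" "x + generator g * y = 0"
  shows "x = 0 \<and> y = 0"
proof -
  have c: "coord x W + coord (generator g * y) W = 0" for W
    using assms(3) by (metis coord_0 coord_add)
  have x: "coord x W = 0" for W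
    using c[of W] assms(1) by (cases "g \<in> W") (auto simp: free_of_def coord_generator_mult)
  have "coord y W = 0" for W
  proof (cases "g \<in> W")
    case True
    with assms(2) show ?thesis by (auto simp: free_of_def)
  next
    case False
    then show ?thesis using c[of "insert g W"] x[of "insert g W"]
      by (simp add: coord_generator_mult) (simp add: shuffle_sign_def)
  qed
  with x show ?thesis by (auto intro: exterior_eqI)
qed

text \<open>The interior product with the dual vector of \<open>g\<close>; the sign accounts for
  moving \<open>g\<close> to the front.\<close>

lift_definition contract :: "'g::linorder \<Rightarrow> 'g exterior \<Rightarrow> 'g exterior"
  is "\<lambda>g f S. if g \<in> S then 0 else shuffle_sign {g} S * f (insert g S)"
proof -
  fix g :: 'g and f :: "'g set \<Rightarrow> complex"
  assume a: "finite {S. f S \<noteq> 0} \<and> (\<forall>S. f S \<noteq> 0 \<longrightarrow> finite S)"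
  have "{S. (if g \<in> S then 0 else shuffle_sign {g} S * f (insert g S)) \<noteq> 0}
      \<subseteq> (\<lambda>S. S - {g}) ` {S. f S \<noteq> 0}"
  proof
    fix S assume "S \<in> {S. (if g \<in> S then 0 else shuffle_sign {g} S * f (insert g S)) \<noteq> 0}"
    then show "S \<in> (\<lambda>S. S - {g}) ` {S. f S \<noteq> 0}"
      by (intro image_eqI[of _ _ "insert g S"]) (auto split: if_splits)
  qed
  moreover have "finite S" if "f (insert g S) \<noteq> 0" for S
    using a that by (metis finite_insert)
  ultimately show "finite {S. (if g \<in> S then 0 else shuffle_sign {g} S * f (insert g S)) \<noteq> 0} \<and>
      (\<forall>S. (if g \<in> S then 0 else shuffle_sign {g} S * f (insert g S)) \<noteq> 0 \<longrightarrow> finite S)"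
    using a by (auto intro: finite_subset split: if_splits)
qed

text \<open>Take \<open>v\<close> to be the contraction of \<open>f\<close> by \<open>g\<close>: as
  signs square to one, \<open>generator g * v\<close> is the part of \<open>f\<close> supported on
  sets containing \<open>g\<close>. The support bounds let \<open>u\<close> and \<open>v\<close>
  inherit gradings from \<open>f\<close>.\<close>

lemma split_generator:
  obtains u v where "f = u + generator g * v"
    "\<And>S. coord u S \<noteq> 0 \<Longrightarrow> g \<notin> S \<and> coord f S \<noteq> 0"
    "\<And>S. coord v S \<noteq> 0 \<Longrightarrow> g \<notin> S \<and> coord f (insert g S) \<noteq> 0"
proof
  let ?v = "contract g f"
  have v: "coord (generator g * ?v) W = (if g \<in> W then coord f W else 0)" for W
    by (auto simp: coord_generator_mult contract.rep_eq insert_absorb shuffle_sign_square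
        simp flip: mult.assoc)
  show "f = (f - generator g * ?v) + generator g * ?v" by simp
  show "g \<notin> S \<and> coord f S \<noteq> 0" if "coord (f - generator g * ?v) S \<noteq> 0" for S
    using that by (auto simp: v split: if_splits)
  show "g \<notin> S \<and> coord f (insert g S) \<noteq> 0" if "coord ?v S \<noteq> 0" for S
    using that by (auto simp: contract.rep_eq split: if_splits)
qed

section \<open>Bidegrees\<close>

text \<open>\<open>False\<close> marks the \<alpha> and \<open>True\<close> the \<theta>, so for
  finite \<open>S\<close> the two values give the bidegree of \<open>basis_vector S\<close>.\<close>

definition deg :: "bool \<Rightarrow> (bool \<times> nat) set \<Rightarrow> int"
  where "deg b S = int (card (Pair b -` S))"

lemma finite_Pair_vimage: "finite S \<Longrightarrow> finite (Pair b -` S)"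
  by (rule finite_vimageI) (auto simp: inj_on_def)

lemma deg_Un:
  assumes "finite S" "finite U" "S \<inter> U = {}"
  shows "deg b (S \<union> U) = deg b S + deg b U"
proof -
  have "Pair b -` S \<inter> Pair b -` U = {}" using assms(3) by auto
  then show ?thesis
    using assms by (simp add: deg_def vimage_Un card_Un_disjoint finite_Pair_vimage)
qed

lemma deg_singleton: "deg b {(c, k)} = (if b = c then 1 else 0)"
proof -
  have "Pair b -` {(c, k)} = (if b = c then {k} else {})" by auto
  then show ?thesis by (simp add: deg_def)
qed

lemma deg_insert:
  "finite S \<Longrightarrow> (c, k) \<notin> S \<Longrightarrow> deg b (insert (c, k) S) = deg b S + (if b = c then 1 else 0)"
  using deg_Un[of "{(c, k)}" S b] by (simp add: deg_singleton)

text \<open>A predicate covers a single bidegree, a total degree and all of \<open>E n\<close>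
  alike, and can be shifted when a generator is removed.\<close>

definition graded :: "nat \<Rightarrow> (int \<Rightarrow> int \<Rightarrow> bool) \<Rightarrow> E_ambient set"
  where "graded n P =
    {x. \<forall>S. coord x S \<noteq> 0 \<longrightarrow> S \<subseteq> UNIV \<times> {1..n} \<and> P (deg False S) (deg True S)}"

lemma gradedD:
  assumes "x \<in> graded n P" "coord x S \<noteq> 0"
  shows "S \<subseteq> UNIV \<times> {1..n}" "P (deg False S) (deg True S)" "finite S"
  using assms coord_infinite by (auto simp: graded_def)

lemma graded_mono: "x \<in> graded n P \<Longrightarrow> (\<And>a b. P a b \<Longrightarrow> Q a b) \<Longrightarrow> x \<in> graded n Q"
  by (auto simp: graded_def)

lemma graded_0: "0 \<in> graded n P"
  by (simp add: graded_def)

lemma graded_add: "x \<in> graded n P \<Longrightarrow> y \<in> graded n P \<Longrightarrow> x + y \<in> graded n P"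
  unfolding graded_def by (simp, metis add.right_neutral)

lemma graded_diff: "x \<in> graded n P \<Longrightarrow> y \<in> graded n P \<Longrightarrow> x - y \<in> graded n P"
  unfolding graded_def by (simp, metis diff_zero)

lemma graded_scaleC: "x \<in> graded n P \<Longrightarrow> c *\<^sub>C x \<in> graded n P"
  by (auto simp: graded_def)

lemma graded_sum: "(\<And>a. a \<in> A \<Longrightarrow> f a \<in> graded n P) \<Longrightarrow> sum f A \<in> graded n P"
  by (induction A rule: infinite_finite_induct) (auto intro: graded_add graded_0)

text \<open>A support set of \<open>x * y\<close> is a disjoint union of one of \<open>x\<close> and
  one of \<open>y\<close>, and degrees add over disjoint unions.\<close>

lemma graded_mult:
  assumes "x \<in> graded n P" "y \<in> graded n Q"
    and R: "\<And>a b c d. P a b \<Longrightarrow> Q c d \<Longrightarrow> R (a + c) (b + d)"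
  shows "x * y \<in> graded n R"
  unfolding graded_def
proof (intro CollectI allI impI)
  fix W assume "coord (x * y) W \<noteq> 0"
  then obtain S where "S \<in> Pow W" "shuffle_sign S (W - S) * coord x S * coord y (W - S) \<noteq> 0"
    unfolding times_exterior.rep_eq using sum.not_neutral_contains_not_neutral by blast
  then have S: "S \<subseteq> W" "coord x S \<noteq> 0" "coord y (W - S) \<noteq> 0" by auto
  note X = gradedD[OF assms(1) S(2)] and Y = gradedD[OF assms(2) S(3)]
  have W: "W = S \<union> (W - S)" using S(1) by auto
  have "deg b W = deg b S + deg b (W - S)" for b
    using deg_Un[of S "W - S" b] X(3) Y(3) W by simp
  then show "W \<subseteq> UNIV \<times> {1..n} \<and> R (deg False W) (deg True W)"
    using R[OF X(2) Y(2)] X(1) Y(1) W by auto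
qed

text \<open>First \<alpha> is split off, then \<theta> from both pieces; each generator removed
  shifts the predicate by its bidegree.\<close>

lemma graded_Suc:
  assumes "f \<in> graded (Suc n) P"
  obtains p q r s where
    "f = (p + theta (Suc n) * q) + alpha (Suc n) * (r + theta (Suc n) * s)"
    "p \<in> graded n P" "q \<in> graded n (\<lambda>a b. P a (b + 1))"
    "r \<in> graded n (\<lambda>a b. P (a + 1) b)" "s \<in> graded n (\<lambda>a b. P (a + 1) (b + 1))"
proof -
  let ?a = "(False, Suc n)" and ?t = "(True, Suc n)"
  obtain u v where f: "f = u + generator ?a * v"
    and u: "\<And>S. coord u S \<noteq> 0 \<Longrightarrow> ?a \<notin> S \<and> coord f S \<noteq> 0"
    and v: "\<And>S. coord v S \<noteq> 0 \<Longrightarrow> ?a \<notin> S \<and> coord f (insert ?a S) \<noteq> 0"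
    using split_generator[of f ?a] by blast
  obtain p q where pq: "u = p + generator ?t * q"
    and p: "\<And>S. coord p S \<noteq> 0 \<Longrightarrow> ?t \<notin> S \<and> coord u S \<noteq> 0"
    and q: "\<And>S. coord q S \<noteq> 0 \<Longrightarrow> ?t \<notin> S \<and> coord u (insert ?t S) \<noteq> 0"
    using split_generator[of u ?t] by blast
  obtain r s where rs: "v = r + generator ?t * s"
    and r: "\<And>S. coord r S \<noteq> 0 \<Longrightarrow> ?t \<notin> S \<and> coord v S \<noteq> 0"
    and s: "\<And>S. coord s S \<noteq> 0 \<Longrightarrow> ?t \<notin> S \<and> coord v (insert ?t S) \<noteq> 0"
    using split_generator[of v ?t] by blast
  have sub: "S \<subseteq> UNIV \<times> {1..n}" if "S \<subseteq> UNIV \<times> {1..Suc n}" "?a \<notin> S" "?t \<notin> S" for S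
  proof
    fix z assume "z \<in> S"
    moreover obtain b k where "z = (b, k)" by (cases z)
    ultimately show "z \<in> UNIV \<times> {1..n}"
      using that by (cases b; cases "k = Suc n") auto
  qed
  note D = gradedD[OF assms]
  show ?thesis
  proof
    show "f = (p + theta (Suc n) * q) + alpha (Suc n) * (r + theta (Suc n) * s)"
      unfolding f pq rs alpha_def theta_def ..
    show "p \<in> graded n P"
      unfolding graded_def
    proof (intro CollectI allI impI)
      fix S assume "coord p S \<noteq> 0"
      then have 1: "?t \<notin> S" "?a \<notin> S" "coord f S \<noteq> 0"
        using p[of S] u[of S] by auto
      with D[OF 1(3)] sub[of S]
      show "S \<subseteq> UNIV \<times> {1..n} \<and> P (deg False S) (deg True S)" by simp
    qed
    show "q \<in> graded n (\<lambda>a b. P a (b + 1))"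
      unfolding graded_def
    proof (intro CollectI allI impI)
      fix S assume "coord q S \<noteq> 0"
      then have 1: "?t \<notin> S" "?a \<notin> S" "coord f (insert ?t S) \<noteq> 0"
        using q[of S] u[of "insert ?t S"] by auto
      with D[OF 1(3)] sub[of S]
      show "S \<subseteq> UNIV \<times> {1..n} \<and> P (deg False S) (deg True S + 1)"
        by (simp add: deg_insert)
    qed
    show "r \<in> graded n (\<lambda>a b. P (a + 1) b)"
      unfolding graded_def
    proof (intro CollectI allI impI)
      fix S assume "coord r S \<noteq> 0"
      then have 1: "?t \<notin> S" "?a \<notin> S" "coord f (insert ?a S) \<noteq> 0"
        using r[of S] v[of S] by auto
      with D[OF 1(3)] sub[of S]
      show "S \<subseteq> UNIV \<times> {1..n} \<and> P (deg False S + 1) (deg True S)"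
        by (simp add: deg_insert)
    qed
    show "s \<in> graded n (\<lambda>a b. P (a + 1) (b + 1))"
      unfolding graded_def
    proof (intro CollectI allI impI)
      fix S assume "coord s S \<noteq> 0"
      then have 1: "?t \<notin> S" "?a \<notin> S" "coord f (insert ?a (insert ?t S)) \<noteq> 0"
        using s[of S] v[of "insert ?t S"] by auto
      with D[OF 1(3)] sub[of S]
      show "S \<subseteq> UNIV \<times> {1..n} \<and> P (deg False S + 1) (deg True S + 1)"
        by (simp add: deg_insert)
    qed
  qed
qed

text \<open>Uniqueness for the decomposition in \<open>graded_Suc\<close>, by splitting off \<alpha>
  and then \<theta>; it lets equations be read componentwise.\<close>

lemma graded_Suc_eq_0:
  assumes "p \<in> graded n P" "q \<in> graded n Q" "r \<in> graded n R" "s \<in> graded n S"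
    and "(p + theta (Suc n) * q) + alpha (Suc n) * (r + theta (Suc n) * s) = 0"
  shows "p = 0 \<and> q = 0 \<and> r = 0 \<and> s = 0"
proof -
  have free: "free_of (b, Suc n) x" if "x \<in> graded n X" for b x X
    using that unfolding free_of_def graded_def by fastforce
  have "p + theta (Suc n) * q = 0 \<and> r + theta (Suc n) * s = 0"
    using assms(5) unfolding alpha_def
    by (rule free_of_split_eq_0[rotated 2])
      (auto simp: theta_def intro!: free_of_add free_of_generator_mult intro: free assms)
  then show ?thesis
    unfolding theta_def using free_of_split_eq_0 free assms(1-4) by metis
qed

text \<open>Converse of \<open>graded_Suc\<close>; it gives the preimage assembled in
  \<open>ell_power_surj\<close> its bidegree.\<close>

lemma graded_lift:
  assumes "p \<in> graded n P" "q \<in> graded n (\<lambda>a b. P a (b + 1))"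
    "r \<in> graded n (\<lambda>a b. P (a + 1) b)" "s \<in> graded n (\<lambda>a b. P (a + 1) (b + 1))"
  shows "(p + theta (Suc n) * q) + alpha (Suc n) * (r + theta (Suc n) * s) \<in> graded (Suc n) P"
proof -
  have up: "x \<in> graded (Suc n) X" if "x \<in> graded n X" for x X
    using that unfolding graded_def by fastforce
  have t: "theta (Suc n) \<in> graded (Suc n) (\<lambda>a b. a = 0 \<and> b = 1)"
    and a: "alpha (Suc n) \<in> graded (Suc n) (\<lambda>a b. a = 1 \<and> b = 0)"
    by (auto simp: graded_def theta_def alpha_def generator_def coord_basis_vector deg_singleton)
  have "theta (Suc n) * q \<in> graded (Suc n) P"
    by (rule graded_mult[OF t up[OF assms(2)]]) (simp add: add.commute)
  moreover have "theta (Suc n) * s \<in> graded (Suc n) (\<lambda>a b. P (a + 1) b)"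
    by (rule graded_mult[OF t up[OF assms(4)]]) (simp add: add.commute)
  then have "alpha (Suc n) * (r + theta (Suc n) * s) \<in> graded (Suc n) P"
    by (intro graded_mult[OF a graded_add[OF up[OF assms(3)]]]) (auto simp: add.commute)
  ultimately show ?thesis using up[OF assms(1)] by (intro graded_add)
qed

section \<open>Bidegree of \<open>ell\<close> and its powers\<close>

lemma alpha_graded: "k \<in> {1..n} \<Longrightarrow> alpha k \<in> graded n (\<lambda>a b. a = 1 \<and> b = 0)"
  and theta_graded: "k \<in> {1..n} \<Longrightarrow> theta k \<in> graded n (\<lambda>a b. a = 0 \<and> b = 1)"
  by (auto simp: graded_def theta_def alpha_def generator_def coord_basis_vector deg_singleton
      split: if_splits)

lemma alpha_theta_graded: "k \<in> {1..n} \<Longrightarrow> alpha k * theta k \<in> graded n (\<lambda>a b. a = 1 \<and> b = 1)"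
  by (rule graded_mult[OF alpha_graded theta_graded]) auto

lemma ell_graded: "ell n \<in> graded n (\<lambda>a b. a = 1 \<and> b = 1)"
  unfolding ell_def by (intro graded_sum alpha_theta_graded)

lemma ell_power_mult_graded:
  assumes "x \<in> graded n P" "\<And>a b. P a b \<Longrightarrow> Q (a + int m) (b + int m)"
  shows "ell n ^ m * x \<in> graded n Q"
  using assms
proof (induction m arbitrary: Q)
  case 0
  show ?case using graded_mono[OF "0.prems"(1)] "0.prems"(2) by simp
next
  case (Suc m)
  have "ell n ^ m * x \<in> graded n (\<lambda>a b. Q (a + 1) (b + 1))"
    by (rule Suc.IH[OF Suc.prems(1)]) (use Suc.prems(2) in \<open>simp add: ac_simps\<close>)
  then have "ell n * (ell n ^ m * x) \<in> graded n Q"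
    by (rule graded_mult[OF ell_graded]) (simp add: add.commute)
  then show ?case by (simp add: mult.assoc)
qed

section \<open>Hard Lefschetz\<close>

lemma generator_swap:
  "generator g * (generator h * z) = - (generator h * (generator g * z :: 'g::linorder exterior))"
  using generator_anticommute[of g h] by (simp flip: mult.assoc)

text \<open>Each \<open>alpha k * theta k\<close> is even: moving a generator across it changes the
  sign twice.\<close>

lemma ell_commute_generator: "ell n * generator g = generator g * ell n"
proof -
  have "generator a * generator b * generator g = generator g * (generator a * generator b)" for a b
    by (simp only: mult.assoc generator_anticommute[of b g] generator_swap[of a g] mult_minus_right
        minus_minus)
  then have "alpha k * theta k * generator g = generator g * (alpha k * theta k)" for k
    by (simp add: alpha_def theta_def)
  then show ?thesis by (simp add: ell_def sum_distrib_left sum_distrib_right)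
qed

lemma ell_Suc: "ell (Suc n) = ell n + alpha (Suc n) * theta (Suc n)"
  by (simp add: ell_def)

text \<open>Here \<open>K\<close> plays the role of the smaller \<open>ell\<close>. Of the product
  with \<open>a * t\<close> only \<open>a * t * p\<close> survives, since every other term repeats
  \<open>a\<close> or \<open>t\<close>.\<close>

lemma Lefschetz_split:
  fixes K a t p q r s :: "'a::ring_1"
  assumes a: "a * a = 0" and t: "t * t = 0" and ta: "t * a = - (a * t)"
    and Ka: "K * a = a * K" and Kt: "K * t = t * K"
  shows "(K + a * t) * ((p + t * q) + a * (r + t * s)) =
    (K * p + t * (K * q)) + a * (K * r + t * (K * s + p))"
proof -
  \<comment> \<open>The relations in right-nested form, so that they still apply after rewriting
    with \<open>mult.assoc\<close>.\<close>
  have a': "a * (a * z) = 0" and t': "t * (t * z) = 0" and ta': "t * (a * z) = - (a * (t * z))"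
    and Ka': "K * (a * z) = a * (K * z)" and Kt': "K * (t * z) = t * (K * z)" for z
    by (metis assms mult.assoc mult_zero_left mult_minus_left)+
  show ?thesis
    by (simp add: distrib_left distrib_right mult.assoc a' t' ta' Ka' Kt')
qed

text \<open>Each further factor adds one copy of the current first component to the last one, which
  produces the integer coefficient. The exponent \<open>Suc m\<close> avoids a truncated
  \<open>m - 1\<close>.\<close>

lemma Lefschetz_power_split:
  fixes K a t p q r s :: "'a::ring_1"
  assumes a: "a * a = 0" and t: "t * t = 0" and ta: "t * a = - (a * t)"
    and Ka: "K * a = a * K" and Kt: "K * t = t * K"
  shows "(K + a * t) ^ Suc m * ((p + t * q) + a * (r + t * s)) =
    (K ^ Suc m * p + t * (K ^ Suc m * q)) +
      a * (K ^ Suc m * r + t * (K ^ Suc m * s + of_nat (Suc m) * (K ^ m * p)))"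
proof (induction m)
  case 0
  show ?case using Lefschetz_split[OF assms] by simp
next
  case (Suc m)
  have "K * (K ^ Suc m * s + of_nat (Suc m) * (K ^ m * p)) + K ^ Suc m * p =
      K ^ Suc (Suc m) * s + of_nat (Suc (Suc m)) * (K ^ Suc m * p)"
  proof -
    have "K * (of_nat (Suc m) * z) = of_nat (Suc m) * (K * z)" for z
      by (metis mult.assoc mult_of_nat_commute)
    then show ?thesis
      by (simp only: distrib_left) (simp add: distrib_right mult.assoc)
  qed
  then show ?case
    unfolding power_Suc[of "K + a * t" "Suc m"] mult.assoc Suc.IH
      Lefschetz_split[OF assms] by (simp add: mult.assoc)
qed

text \<open>The integer factor becomes a complex scalar, which can later be divided out.\<close>

lemma ell_power_Suc_split:
  "ell (Suc n) ^ Suc m *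
      ((p + theta (Suc n) * q) + alpha (Suc n) * (r + theta (Suc n) * s)) =
    (ell n ^ Suc m * p + theta (Suc n) * (ell n ^ Suc m * q)) +
      alpha (Suc n) * (ell n ^ Suc m * r +
        theta (Suc n) * (ell n ^ Suc m * s + of_nat (Suc m) *\<^sub>C (ell n ^ m * p)))"
  unfolding ell_Suc of_nat_mult_exterior[symmetric] alpha_def theta_def
  by (intro Lefschetz_power_split generator_square generator_anticommute ell_commute_generator)

text \<open>\<open>E 0\<close> consists of scalars, which have bidegree
  \<open>(0, 0)\<close>.\<close>

lemma graded_zero_cases:
  assumes "x \<in> graded 0 P" "\<not> P 0 0"
  shows "x = 0"
proof (rule exterior_eqI)
  fix S
  show "coord x S = coord 0 S"
  proof (rule ccontr)
    assume "coord x S \<noteq> coord 0 S"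
    with gradedD[OF assms(1), of S] have "S = {}" "P (deg False S) (deg True S)" by auto
    with assms(2) show False by (simp add: deg_def)
  qed
qed

text \<open>
  Degrees are integers, so that the components of \<open>graded_Suc\<close> always have a degree; those with a
  negative one vanish.
\<close>

lemma ell_power_inj:
  assumes "k \<le> int n" "f \<in> graded n (\<lambda>a b. a + b = k)" "ell n ^ nat (int n - k) * f = 0"
  shows "f = 0"
  using assms
proof (induction n arbitrary: k f)
  case 0
  then show ?case using graded_zero_cases[OF "0.prems"(2)] by (cases "k = 0") auto
next
  case (Suc n)
  show ?case
  proof (cases "k = int (Suc n)")
    case True
    \<comment> \<open>The exponent is 0 here.\<close>
    with Suc.prems show ?thesis by simp
  next
    case False
    \<comment> \<open>Over \<open>n\<close>, the induction hypothesis has exponent \<open>m\<close>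
      for \<open>p\<close> in degree \<open>k\<close>, \<open>m + 1\<close> for \<open>q\<close> and
      \<open>r\<close> in degree \<open>k - 1\<close>, and \<open>m + 2\<close> for \<open>s\<close>
      in degree \<open>k - 2\<close>.\<close>
    define m where "m = nat (int n - k)"
    have m: "nat (int (Suc n) - k) = Suc m" "nat (int n - (k - 1)) = Suc m"
      "nat (int n - (k - 2)) = Suc (Suc m)" "k \<le> int n"
      using Suc.prems(1) False by (auto simp: m_def)
    obtain p q r s where
      f: "f = (p + theta (Suc n) * q) + alpha (Suc n) * (r + theta (Suc n) * s)"
      and p: "p \<in> graded n (\<lambda>a b. a + b = k)" and q': "q \<in> graded n (\<lambda>a b. a + (b + 1) = k)"
      and r': "r \<in> graded n (\<lambda>a b. (a + 1) + b = k)"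
      and s': "s \<in> graded n (\<lambda>a b. (a + 1) + (b + 1) = k)"
      by (rule graded_Suc[OF Suc.prems(2)])
    have q: "q \<in> graded n (\<lambda>a b. a + b = k - 1)" and r: "r \<in> graded n (\<lambda>a b. a + b = k - 1)"
      and s: "s \<in> graded n (\<lambda>a b. a + b = k - 2)"
      by (rule graded_mono[OF q'] graded_mono[OF r'] graded_mono[OF s']; simp)+
    \<comment> \<open>Reading off components only requires that no generator of index
      \<open>Suc n\<close> occurs, hence the trivial predicate.\<close>
    have top: "x \<in> graded n X \<Longrightarrow> ell n ^ i * x \<in> graded n (\<lambda>_ _. True)" for x X i
      by (rule ell_power_mult_graded[of x n X]) auto
    let ?s = "ell n ^ Suc m * s + of_nat (Suc m) *\<^sub>C (ell n ^ m * p)"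
    have zero: "ell n ^ Suc m * p = 0 \<and> ell n ^ Suc m * q = 0 \<and> ell n ^ Suc m * r = 0 \<and> ?s = 0"
      using Suc.prems(3)[unfolded m(1) f ell_power_Suc_split]
      by (intro graded_Suc_eq_0[OF top[OF p] top[OF q] top[OF r]
            graded_add[OF top[OF s] graded_scaleC[OF top[OF p]]]])
    have "q = 0" "r = 0"
      using zero Suc.IH[of "k - 1"] q r m by auto
    have "ell n ^ Suc (Suc m) * s = ell n * ?s - of_nat (Suc m) *\<^sub>C (ell n ^ Suc m * p)"
      by (simp add: distrib_left scaleC_mult_right mult.assoc del: of_nat_Suc)
    with zero have "s = 0" using Suc.IH[OF _ s] m by simp
    with zero have "of_nat (Suc m) *\<^sub>C (ell n ^ m * p) = 0" by simp
    \<comment> \<open>Characteristic zero enters: \<open>Suc m\<close> is an invertible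
      scalar.\<close>
    then have "ell n ^ m * p = 0"
      by (subst (asm) exterior.scale_eq_0_iff) (simp del: of_nat_Suc)
    then have "p = 0" using Suc.IH[OF m(4) p] by (simp add: m_def)
    with \<open>q = 0\<close> \<open>r = 0\<close> \<open>s = 0\<close> show ?thesis by (simp add: f)
  qed
qed

text \<open>The component equations are solved by induction: \<open>q'\<close> and \<open>r'\<close>
  directly, then \<open>s'\<close> after eliminating \<open>p'\<close>, and finally
  \<open>p'\<close>.\<close>

lemma ell_power_surj:
  assumes "i + j \<le> int n" "g \<in> graded n (\<lambda>a b. a = int n - j \<and> b = int n - i)"
  shows "\<exists>f\<in>graded n (\<lambda>a b. a = i \<and> b = j). ell n ^ nat (int n - i - j) * f = g"
  using assms
proof (induction n arbitrary: i j g)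
  case 0
  show ?case
  proof (cases "i + j = 0")
    case True
    \<comment> \<open>The exponent is 0 and the bidegree \<open>(-j, -i)\<close> of \<open>g\<close>
      equals \<open>(i, j)\<close>.\<close>
    with "0.prems"(1) show ?thesis by (intro bexI[of _ g] graded_mono[OF "0.prems"(2)]) auto
  next
    case False
    then have "g = 0" using graded_zero_cases[OF "0.prems"(2)] by auto
    then show ?thesis by (intro bexI[of _ 0] graded_0) simp
  qed
next
  case (Suc n)
  show ?case
  proof (cases "i + j = int (Suc n)")
    case True
    then show ?thesis by (intro bexI[of _ g] graded_mono[OF Suc.prems(2)]) auto
  next
    case False
    define m where "m = nat (int n - i - j)"
    have m: "nat (int (Suc n) - i - j) = Suc m" "nat (int n - (i - 1) - j) = Suc m"
      "nat (int n - i - (j - 1)) = Suc m"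
      "nat (int n - (i - 1) - (j - 1)) = Suc (Suc m)" "i + j \<le> int n" "int m = int n - i - j"
      using Suc.prems(1) False by (auto simp: m_def)
    let ?B = "\<lambda>i j. graded n (\<lambda>a b. a = i \<and> b = j)"
    obtain p q r s where
      g: "g = (p + theta (Suc n) * q) + alpha (Suc n) * (r + theta (Suc n) * s)"
      and p1: "p \<in> graded n (\<lambda>a b. a = int (Suc n) - j \<and> b = int (Suc n) - i)"
      and q1: "q \<in> graded n (\<lambda>a b. a = int (Suc n) - j \<and> b + 1 = int (Suc n) - i)"
      and r1: "r \<in> graded n (\<lambda>a b. a + 1 = int (Suc n) - j \<and> b = int (Suc n) - i)"
      and s1: "s \<in> graded n (\<lambda>a b. a + 1 = int (Suc n) - j \<and> b + 1 = int (Suc n) - i)"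
      by (rule graded_Suc[OF Suc.prems(2)])
    \<comment> \<open>The roles cross: the target bidegree of \<open>p\<close> is the one paired
      with the source bidegree \<open>(i - 1, j - 1)\<close> of \<open>s'\<close>, and that of
      \<open>s\<close> with the source bidegree \<open>(i, j)\<close> of \<open>p'\<close>.\<close>
    have p: "p \<in> ?B (int n - (j - 1)) (int n - (i - 1))" and q: "q \<in> ?B (int n - (j - 1)) (int n - i)"
      and r: "r \<in> ?B (int n - j) (int n - (i - 1))" and s: "s \<in> ?B (int n - j) (int n - i)"
      by (rule graded_mono[OF p1] graded_mono[OF q1] graded_mono[OF r1] graded_mono[OF s1]; simp)+
    obtain q' where q': "q' \<in> ?B i (j - 1)" "ell n ^ Suc m * q' = q"
      using Suc.IH[OF _ q] m by auto
    obtain r' where r': "r' \<in> ?B (i - 1) j" "ell n ^ Suc m * r' = r"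
      using Suc.IH[OF _ r] m by auto
    \<comment> \<open>This right-hand side for \<open>s'\<close> arises by multiplying the equation
      for \<open>s\<close> by \<open>ell n\<close> and substituting the one for
      \<open>p\<close>.\<close>
    have "ell n * s - of_nat (Suc m) *\<^sub>C p \<in> ?B (int n - (j - 1)) (int n - (i - 1))"
      by (intro graded_diff graded_scaleC p graded_mult[OF ell_graded s]) auto
    then obtain s' where s': "s' \<in> ?B (i - 1) (j - 1)"
      "ell n ^ Suc (Suc m) * s' = ell n * s - of_nat (Suc m) *\<^sub>C p"
      using Suc.IH[of "i - 1" "j - 1"] m by auto
    have "ell n ^ Suc m * s' \<in> ?B (int n - j) (int n - i)"
      by (rule ell_power_mult_graded[OF s'(1)]) (use m(6) in auto)
    then have "(1 / of_nat (Suc m)) *\<^sub>C (s - ell n ^ Suc m * s') \<in> ?B (int n - j) (int n - i)"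
      by (intro graded_diff graded_scaleC s)
    then obtain p' where p': "p' \<in> ?B i j"
      "ell n ^ m * p' = (1 / of_nat (Suc m)) *\<^sub>C (s - ell n ^ Suc m * s')"
      using Suc.IH[OF m(5)] m_def by metis
    have s_eq: "ell n ^ Suc m * s' + of_nat (Suc m) *\<^sub>C (ell n ^ m * p') = s"
      by (simp add: p'(2) del: of_nat_Suc)
    \<comment> \<open>The equation for \<open>p\<close> now follows from the choice of
      \<open>s'\<close>.\<close>
    have "ell n ^ Suc m * p' = (1 / of_nat (Suc m)) *\<^sub>C (ell n * s - ell n ^ Suc (Suc m) * s')"
      using p'(2) by (simp add: mult.assoc scaleC_mult_right right_diff_distrib del: of_nat_Suc)
    also have "\<dots> = p" unfolding s'(2) by (simp del: of_nat_Suc)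
    finally have p_eq: "ell n ^ Suc m * p' = p" .
    let ?f = "(p' + theta (Suc n) * q') + alpha (Suc n) * (r' + theta (Suc n) * s')"
    have "?f \<in> graded (Suc n) (\<lambda>a b. a = i \<and> b = j)"
      by (intro graded_lift graded_mono[OF p'(1)] graded_mono[OF q'(1)] graded_mono[OF r'(1)]
          graded_mono[OF s'(1)]) auto
    moreover have "ell (Suc n) ^ Suc m * ?f = g"
      unfolding ell_power_Suc_split p_eq q'(2) r'(2) s_eq g ..
    ultimately show ?thesis unfolding m(1) by blast
  qed
qed

section \<open>The homomorphism\<close>

lemma E_eq_graded: "E n = graded n (\<lambda>_ _. True)"
  by (simp add: set_eq_iff mem_E_iff graded_def)

lemma basis_vector_deg:
  assumes "S \<subseteq> UNIV \<times> {1..n}"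
  obtains I J where "I \<subseteq> {1..n}" "J \<subseteq> {1..n}" "basis_vector S = monomial I J"
    "deg False S = int (card I)" "deg True S = int (card J)"
proof
  let ?I = "Pair False -` S" and ?J = "Pair True -` S"
  show sub: "?I \<subseteq> {1..n}" "?J \<subseteq> {1..n}" using assms by auto
  have "S = Pair False ` ?I \<union> Pair True ` ?J"
  proof safe
    fix b k assume "(b, k) \<in> S" "(b, k) \<notin> Pair True ` ?J"
    then show "(b, k) \<in> Pair False ` ?I" by (cases b) auto
  qed
  with sub show "basis_vector S = monomial ?I ?J"
    by (metis basis_vector_eq_monomial finite_atLeastAtMost finite_subset)
qed (simp_all add: deg_def)

lemma E_bideg_eq_graded: "E_bideg n i j = graded n (\<lambda>a b. a = int i \<and> b = int j)"
proof (intro equalityI subsetI)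
  fix x assume "x \<in> E_bideg n i j"
  then show "x \<in> graded n (\<lambda>a b. a = int i \<and> b = int j)"
    unfolding E_bideg_def
  proof (induction rule: exterior.span_induct_alt)
    case base
    show ?case by (rule graded_0)
  next
    case (step c x y)
    then obtain I J where IJ: "I \<subseteq> {1..n}" "J \<subseteq> {1..n}" "x = monomial I J" "card I = i" "card J = j"
      by auto
    then have fin: "finite I" "finite J" by (auto intro: finite_subset)
    have "Pair False -` (Pair False ` I \<union> Pair True ` J) = I"
      "Pair True -` (Pair False ` I \<union> Pair True ` J) = J" by auto
    then have "x \<in> graded n (\<lambda>a b. a = int i \<and> b = int j)"
      using IJ fin by (auto simp: basis_vector_eq_monomial[symmetric] graded_def coord_basis_vector deg_def
          split: if_splits)
    with step show ?case by (intro graded_add graded_scaleC)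
  qed
next
  fix x assume x: "x \<in> graded n (\<lambda>a b. a = int i \<and> b = int j)"
  have "basis_vector S \<in> E_bideg n i j" if S: "coord x S \<noteq> 0" for S
  proof -
    obtain I J where "I \<subseteq> {1..n}" "J \<subseteq> {1..n}" "basis_vector S = monomial I J"
      "deg False S = int (card I)" "deg True S = int (card J)"
      by (rule basis_vector_deg[OF gradedD(1)[OF x S]])
    with gradedD(2)[OF x S] show ?thesis
      unfolding E_bideg_def by (intro exterior.span_base) auto
  qed
  then have "(\<Sum>S | coord x S \<noteq> 0. coord x S *\<^sub>C basis_vector S) \<in> E_bideg n i j"
    unfolding E_bideg_def by (intro exterior.span_sum exterior.span_scale) auto
  then show "x \<in> E_bideg n i j"
    using exterior_expand[of "{S. coord x S \<noteq> 0}" x] coord_finite[of x] by simp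
qed

lemma E_mult: "x \<in> E n \<Longrightarrow> y \<in> E n \<Longrightarrow> x * y \<in> E n"
  unfolding E_eq_graded by (rule graded_mult) auto

text \<open>Additivity of \<open>T\<close> is known only on \<open>E n\<close>, so partial sums must
  stay there; the empty sum is handled by scaling with 0.\<close>

lemma algebra_hom_on_sum:
  assumes "algebra_hom_on (E n) B T" "\<And>a. a \<in> A \<Longrightarrow> f a \<in> E n"
  shows "T (sum f A) = (\<Sum>a\<in>A. T (f a))"
proof -
  have T0: "T 0 = 0"
  proof -
    have "0 \<in> E n" by (simp add: E_eq_graded graded_0)
    then have "T (0 *\<^sub>C 0) = 0 *\<^sub>C T 0" using assms(1) unfolding algebra_hom_on_def by blast
    then show ?thesis by simp
  qed
  show ?thesis
    using assms(2)
  proof (induction A rule: infinite_finite_induct)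
    case (insert a A)
    have "sum f A \<in> E n"
      using insert.prems unfolding E_eq_graded by (intro graded_sum) auto
    moreover have "f a \<in> E n" using insert.prems by simp
    ultimately have "T (f a + sum f A) = T (f a) + T (sum f A)"
      using assms(1) unfolding algebra_hom_on_def by blast
    then show ?case using insert by simp
  qed (simp_all add: T0)
qed

section \<open>The action of \<open>T\<close> on \<open>ell\<close> and on degrees\<close>

locale translation_hom =
  fixes n :: nat and T :: "E_ambient \<Rightarrow> E_ambient"
  assumes hom: "algebra_hom_on (E n) (E n) T"
    and T_theta: "\<And>k. k \<in> {1..n} \<Longrightarrow> T (theta k) = theta k + alpha k"
    and T_alpha: "\<And>k. k \<in> {1..n} \<Longrightarrow> T (alpha k) = alpha k"
begin

lemma T_add: "x \<in> E n \<Longrightarrow> y \<in> E n \<Longrightarrow> T (x + y) = T x + T y"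
  and T_mult: "x \<in> E n \<Longrightarrow> y \<in> E n \<Longrightarrow> T (x * y) = T x * T y"
  and T_scaleC: "x \<in> E n \<Longrightarrow> T (c *\<^sub>C x) = c *\<^sub>C T x"
  and T_1: "T 1 = 1"
  using hom unfolding algebra_hom_on_def by auto

lemma alpha_E: "k \<in> {1..n} \<Longrightarrow> alpha k \<in> E n"
  and theta_E: "k \<in> {1..n} \<Longrightarrow> theta k \<in> E n"
  unfolding E_eq_graded by (blast intro: graded_mono[OF alpha_graded] graded_mono[OF theta_graded])+

lemma ell_E: "ell n \<in> E n"
  unfolding E_eq_graded by (rule graded_mono[OF ell_graded]) simp

text \<open>The extra term \<open>alpha k * alpha k\<close> in the image of
  \<open>alpha k * theta k\<close> vanishes.\<close>

lemma T_ell: "T (ell n) = ell n"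
proof -
  have "T (alpha k * theta k) = alpha k * theta k" if "k \<in> {1..n}" for k
    using that by (simp add: T_mult alpha_E theta_E T_alpha T_theta distrib_left)
      (simp add: alpha_def generator_square)
  then show ?thesis
    unfolding ell_def by (subst algebra_hom_on_sum[OF hom]) (simp_all add: E_mult alpha_E theta_E)
qed

lemma T_ell_power_mult: "f \<in> E n \<Longrightarrow> T (ell n ^ m * f) = ell n ^ m * T f"
proof (induction m)
  case (Suc m)
  have "ell n ^ m * f \<in> E n"
    using Suc.prems unfolding E_eq_graded by (rule ell_power_mult_graded)
  with Suc show ?case by (simp add: mult.assoc T_mult ell_E T_ell)
qed simp

text \<open>\<open>T\<close> mixes bidegrees, but it sends each generator to an element of total
  degree 1, and basis vectors are products of generators. Hence injectivity is needed in total
  degree.\<close>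

lemma T_total_degree:
  assumes "f \<in> graded n (\<lambda>a b. a + b = k)"
  shows "T f \<in> graded n (\<lambda>a b. a + b = k)"
proof -
  have E: "basis_vector S \<in> E n" if "finite S" "S \<subseteq> UNIV \<times> {1..n}" for S
    using that by (auto simp: mem_E_iff coord_basis_vector split: if_splits)
  have basis: "T (basis_vector S) \<in> graded n (\<lambda>a b. a + b = deg False S + deg True S)"
    if "finite S" "S \<subseteq> UNIV \<times> {1..n}" for S
    using that
  proof (induction S rule: finite_linorder_min_induct)
    case empty
    have "basis_vector {} = (1 :: E_ambient)" by (simp add: basis_vector_eq_increasing_product)
    then show ?case
      by (auto simp: T_1 graded_def one_exterior.rep_eq split: if_splits)
  next
    case (insert g S)
    obtain c l where g: "g = (c, l)" by (cases g)
    have l: "l \<in> {1..n}" and S: "S \<subseteq> UNIV \<times> {1..n}" and gS: "g \<notin> S"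
      using insert by (auto simp: g)
    have eq: "basis_vector (insert g S) = generator g * basis_vector S"
      using insert.hyps by (simp add: basis_vector_eq_increasing_product increasing_product_insert_min)
    have gE: "generator g \<in> E n"
      unfolding generator_def using l by (intro E) (auto simp: g)
    have "T (generator g) = (if c then theta l + alpha l else alpha l)"
      using T_alpha[OF l] T_theta[OF l] by (simp add: g alpha_def theta_def)
    also have "\<dots> \<in> graded n (\<lambda>a b. a + b = 1)"
      by (auto intro!: graded_add graded_mono[OF alpha_graded[OF l]] graded_mono[OF theta_graded[OF l]])
    finally have Tg: "T (generator g) \<in> graded n (\<lambda>a b. a + b = 1)" .
    have "deg False (insert g S) + deg True (insert g S) = 1 + (deg False S + deg True S)"
      using insert.hyps(1) gS by (simp add: g deg_insert)
    then show ?case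
      unfolding eq T_mult[OF gE E[OF insert.hyps(1) S]]
      by (intro graded_mult[OF Tg insert.IH[OF S]]) auto
  qed
  have f: "f = (\<Sum>S | coord f S \<noteq> 0. coord f S *\<^sub>C basis_vector S)"
    by (rule exterior_expand) (simp_all add: coord_finite)
  have bE: "basis_vector S \<in> E n" if "coord f S \<noteq> 0" for S
    using gradedD[OF assms that] E by blast
  have sE: "coord f S *\<^sub>C basis_vector S \<in> E n" if "coord f S \<noteq> 0" for S
    using bE[OF that] unfolding E_eq_graded by (rule graded_scaleC)
  have "T f = (\<Sum>S | coord f S \<noteq> 0. T (coord f S *\<^sub>C basis_vector S))"
    by (subst f, rule algebra_hom_on_sum[OF hom]) (use sE in auto)
  also have "\<dots> = (\<Sum>S | coord f S \<noteq> 0. coord f S *\<^sub>C T (basis_vector S))"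
    by (intro sum.cong) (auto simp: T_scaleC bE)
  also have "\<dots> \<in> graded n (\<lambda>a b. a + b = k)"
  proof (intro graded_sum graded_scaleC)
    fix S assume "S \<in> {S. coord f S \<noteq> 0}"
    then have "coord f S \<noteq> 0" by simp
    from gradedD[OF assms this] basis[of S]
    show "T (basis_vector S) \<in> graded n (\<lambda>a b. a + b = k)" by simp
  qed
  finally show ?thesis .
qed

lemma graded_imp_E: "f \<in> graded n P \<Longrightarrow> f \<in> E n"
  unfolding E_eq_graded by (erule graded_mono) (rule TrueI)

lemma H0_bideg_eq: "H0_bideg n T i j = {f \<in> graded n (\<lambda>a b. a = int i \<and> b = int j). T f = f}"
  unfolding H0_bideg_def H0_def E_eq_graded E_bideg_eq_graded
  using graded_mono[of _ n _ "\<lambda>_ _. True"] by blast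

lemma H0_bideg_subspace: "exterior_subspace (H0_bideg n T i j)"
proof -
  have "T 0 = 0" using algebra_hom_on_sum[OF hom, of "{}"] by simp
  then show ?thesis
    unfolding exterior.subspace_def H0_bideg_eq
    by (auto simp: graded_0 graded_add graded_scaleC
        T_add[OF graded_imp_E graded_imp_E] T_scaleC[OF graded_imp_E])
qed

end

theorem theorem3p4:
  fixes n i j :: nat and T :: "E_ambient \<Rightarrow> E_ambient"
  assumes "n \<ge> 1"
    and "algebra_hom_on (E n) (E n) T"
    and "\<forall>k\<in>{1..n}. T (theta k) = theta k + alpha k"
    and "\<forall>k\<in>{1..n}. T (alpha k) = alpha k"
    and "i + j \<le> n"
  shows "linear_iso_on (H0_bideg n T i j) (H0_bideg n T (n - j) (n - i))
    (\<lambda>f. ell n ^ (n - i - j) * f)"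
proof -
  interpret translation_hom n T
    using assms by unfold_locales auto
  let ?m = "n - i - j" and ?k = "int i + int j"
  let ?V = "H0_bideg n T i j" and ?W = "H0_bideg n T (n - j) (n - i)"
  have m: "?m = nat (int n - ?k)" "?m = nat (int n - int i - int j)" "?k \<le> int n"
    using assms(5) by auto
  have V_total: "f \<in> graded n (\<lambda>a b. a + b = ?k)" if "f \<in> graded n (\<lambda>a b. a = int i \<and> b = int j)" for f
    using that by (rule graded_mono) auto
  have "inj_on (\<lambda>f. ell n ^ ?m * f) ?V"
  proof (rule inj_onI)
    fix x y assume xy: "x \<in> ?V" "y \<in> ?V" "ell n ^ ?m * x = ell n ^ ?m * y"
    then have "x - y \<in> graded n (\<lambda>a b. a + b = ?k)"
      by (intro graded_diff V_total) (auto simp: H0_bideg_eq)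
    moreover have "ell n ^ ?m * (x - y) = 0" using xy(3) by (simp add: right_diff_distrib)
    ultimately have "x - y = 0" using ell_power_inj[OF m(3)] m(1) by metis
    then show "x = y" by simp
  qed
  moreover have "ell n ^ ?m * f \<in> ?W" if "f \<in> ?V" for f
  proof -
    have f: "f \<in> graded n (\<lambda>a b. a = int i \<and> b = int j)" "T f = f"
      using that by (auto simp: H0_bideg_eq)
    have "ell n ^ ?m * f \<in> graded n (\<lambda>a b. a = int (n - j) \<and> b = int (n - i))"
      by (rule ell_power_mult_graded[OF f(1)]) (use assms(5) in auto)
    moreover have "T (ell n ^ ?m * f) = ell n ^ ?m * f"
      using T_ell_power_mult graded_imp_E f by metis
    ultimately show ?thesis by (simp add: H0_bideg_eq)
  qed
  moreover have "\<exists>f\<in>?V. ell n ^ ?m * f = g" if "g \<in> ?W" for g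
  proof -
    \<comment> \<open>As \<open>i\<close> and \<open>j\<close> are at most \<open>n\<close>, the
      truncated differences are genuine ones.\<close>
    have "g \<in> graded n (\<lambda>a b. a = int n - int j \<and> b = int n - int i)" and Tg: "T g = g"
      using that assms(5) by (auto simp: H0_bideg_eq of_nat_diff)
    then obtain f where f: "f \<in> graded n (\<lambda>a b. a = int i \<and> b = int j)" and g: "ell n ^ ?m * f = g"
      using ell_power_surj[of "int i" "int j"] m by metis
    have "T f - f \<in> graded n (\<lambda>a b. a + b = ?k)"
      using V_total[OF f] T_total_degree by (intro graded_diff)
    moreover have "ell n ^ ?m * (T f - f) = T (ell n ^ ?m * f) - ell n ^ ?m * f"
      using T_ell_power_mult[OF graded_imp_E[OF f]] by (simp add: right_diff_distrib)
    then have "ell n ^ ?m * (T f - f) = 0" unfolding g Tg by simp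
    ultimately have "T f - f = 0" using ell_power_inj[OF m(3)] m(1) by metis
    with f g show ?thesis by (auto simp: H0_bideg_eq)
  qed
  ultimately have "bij_betw (\<lambda>f. ell n ^ ?m * f) ?V ?W"
    unfolding bij_betw_def by blast
  then show ?thesis
    unfolding linear_iso_on_def
    by (simp add: H0_bideg_subspace distrib_left scaleC_mult_right)
qed

end
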